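(* Let $n\ge 1$, let $a\in\mathbb{C}$ with $a\neq 0$, and let $\mathfrak{l}_{2n+1}^{J_a}$ be the complex Heisenberg Leibniz algebra with its basis $\{e_1,\dots,e_n,f_1,\dots,f_n,z\}$. Let $d\colon\mathfrak{l}_{2n+1}^{J_a}\to\mathfrak{l}_{2n+1}^{J_a}$ be a linear endomorphism with $d(z)=\gamma z$ for some $\gamma\in\mathbb{C}$. Then $d$ is a derivation of $\mathfrak{l}_{2n+1}^{J_a}$ if and only if its matrix with respect to this basis has the form $$\begin{pmatrix} A & 0 & 0\\ 0 & D & 0\\ \mu & \nu & \gamma\end{pmatrix},$$ where $\mu=(\mu_1,\dots,\mu_n)$ and $\nu=(\nu_1,\dots,\nu_n)$ are arbitrary row vectors in $\mathbb{C}^n$, and, for some $\alpha_1,\dots,\alpha_n,\beta_1\in\mathbb{C}$, one has $\gamma=\alpha_1+\beta_1$; $A$ is the $n\times n$ upper triangular Toeplitz matrix with $A_{ij}=\alpha_{j-i+1}$ for $i\le j$ and $A_{ij}=0$ for $i>j$; and $D$ is the $n\times n$ lower triangular Toeplitz matrix with $D_{ii}=\beta_1$, $D_{ij}=-\alpha_{i-j+1}$ for $i>j$ and $D_{ij}=0$ for $i<j$.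
   Context: For $a\in\mathbb{C}$ and $n\ge 1$, the Heisenberg Leibniz algebra $\mathfrak{l}_{2n+1}^{J_a}$ is the complex algebra with basis $\{e_1,\dots,e_n,f_1,\dots,f_n,z\}$ and bilinear bracket whose nonzero values on basis elements are $[e_i,f_i]=(1+a)z$, $[f_i,e_i]=(-1+a)z$ for $i=1,\dots,n$, and $[e_i,f_{i-1}]=[f_{i-1},e_i]=z$ for $i=2,\dots,n$. A derivation of an algebra $L$ with bracket $[-,-]$ is a linear map $d\colon L\to L$ with $d([x,y])=[d(x),y]+[x,d(y)]$ for all $x,y\in L$. The matrix of $d$ with respect to the ordered basis $(e_1,\dots,e_n,f_1,\dots,f_n,z)$ has as columns the coordinates of the images of the basis vectors. *)

theory Defs
  imports Complex_Main "Jordan_Normal_Form.Matrix"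
begin

definition bilinear_bracket :: "('k::field \<Rightarrow> 'v::ab_group_add \<Rightarrow> 'v) \<Rightarrow> ('v \<Rightarrow> 'v \<Rightarrow> 'v) \<Rightarrow> bool" where
  "bilinear_bracket scale br \<longleftrightarrow>
     (\<forall>y. Vector_Spaces.linear scale scale (\<lambda>x. br x y)) \<and>
     (\<forall>x. Vector_Spaces.linear scale scale (\<lambda>y. br x y))"

definition derivation :: "('k::field \<Rightarrow> 'v::ab_group_add \<Rightarrow> 'v) \<Rightarrow> ('v \<Rightarrow> 'v \<Rightarrow> 'v) \<Rightarrow> ('v \<Rightarrow> 'v) \<Rightarrow> bool" where
  "derivation scale br d \<longleftrightarrow>
     Vector_Spaces.linear scale scale d \<and> (\<forall>x y. d (br x y) = br (d x) y + br x (d y))"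

text \<open>Meaningful when \<open>bs\<close> is a duplicate-free list enumerating a basis. Matrix rows and columns
  are indexed from 0; column \<open>j\<close> holds the coordinates of \<open>d (bs ! j)\<close>.\<close>

definition matrix_of :: "('k::field \<Rightarrow> 'v::ab_group_add \<Rightarrow> 'v) \<Rightarrow> 'v list \<Rightarrow> ('v \<Rightarrow> 'v) \<Rightarrow> 'k mat" where
  "matrix_of scale bs d =
     mat (length bs) (length bs)
       (\<lambda>(i, j). module.representation scale (set bs) (d (bs ! j)) (bs ! i))"

definition heis_basis :: "nat \<Rightarrow> (nat \<Rightarrow> 'v) \<Rightarrow> (nat \<Rightarrow> 'v) \<Rightarrow> 'v \<Rightarrow> 'v list" where
  "heis_basis n e f z = map e [1..<n+1] @ map f [1..<n+1] @ [z]"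

text \<open>The algebra is given by any complex vector space with a basis and a bracket having the
  prescribed structure constants, which determine it up to isomorphism. The families \<open>e\<close> and
  \<open>f\<close> are used at the indices \<open>1, \<dots>, n\<close> only.\<close>

locale heisenberg_leibniz = vector_space scale
  for scale :: "complex \<Rightarrow> 'v::ab_group_add \<Rightarrow> 'v" +
  fixes n :: nat and a :: complex
    and br :: "'v \<Rightarrow> 'v \<Rightarrow> 'v"
    and e f :: "nat \<Rightarrow> 'v" and z :: 'v
  assumes basis_distinct: "distinct (heis_basis n e f z)"
    and basis_independent: "\<not> module.dependent scale (set (heis_basis n e f z))"
    and basis_span: "module.span scale (set (heis_basis n e f z)) = UNIV"
    and bilinear: "bilinear_bracket scale br"
    and br_e_f: "\<And>i j. i \<in> {1..n} \<Longrightarrow> j \<in> {1..n} \<Longrightarrow>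
        br (e i) (f j) = (if j = i then scale (1 + a) z else if i = j + 1 then z else 0)"
    and br_f_e: "\<And>i j. i \<in> {1..n} \<Longrightarrow> j \<in> {1..n} \<Longrightarrow>
        br (f j) (e i) = (if j = i then scale (-1 + a) z else if i = j + 1 then z else 0)"
    and br_e_e: "\<And>i j. i \<in> {1..n} \<Longrightarrow> j \<in> {1..n} \<Longrightarrow> br (e i) (e j) = 0"
    and br_f_f: "\<And>i j. i \<in> {1..n} \<Longrightarrow> j \<in> {1..n} \<Longrightarrow> br (f i) (f j) = 0"
    and br_z_left: "\<And>y. y \<in> set (heis_basis n e f z) \<Longrightarrow> br z y = 0"
    and br_z_right: "\<And>x. x \<in> set (heis_basis n e f z) \<Longrightarrow> br x z = 0"

text \<open>Parameters are 1-based (\<open>\<alpha> 1, \<dots>, \<alpha> n\<close>), matrix indices 0-based; the Toeplitz offset is the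
  same in both conventions.\<close>

definition toeplitz_A :: "nat \<Rightarrow> (nat \<Rightarrow> complex) \<Rightarrow> complex mat" where
  "toeplitz_A n \<alpha> = mat n n (\<lambda>(i, j). if i \<le> j then \<alpha> (j - i + 1) else 0)"

definition toeplitz_D :: "nat \<Rightarrow> (nat \<Rightarrow> complex) \<Rightarrow> complex \<Rightarrow> complex mat" where
  "toeplitz_D n \<alpha> \<beta>\<^sub>1 =
     mat n n (\<lambda>(i, j). if i = j then \<beta>\<^sub>1 else if i > j then - \<alpha> (i - j + 1) else 0)"

definition derivation_matrix ::
    "nat \<Rightarrow> complex mat \<Rightarrow> complex mat \<Rightarrow> complex vec \<Rightarrow> complex vec \<Rightarrow> complex \<Rightarrow> complex mat" where
  "derivation_matrix n A D \<mu> \<nu> \<gamma> =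
     four_block_mat
       (four_block_mat A (0\<^sub>m n n) (0\<^sub>m n n) D) (0\<^sub>m (2 * n) 1)
       (mat_of_row (\<mu> @\<^sub>v \<nu>))                  (mat 1 1 (\<lambda>_. \<gamma>))"

end

theory Submission
  imports Defs
begin

text \<open>
  The bracket takes values in the line spanned by \<open>z\<close>, and \<open>z\<close> brackets to zero with everything,
  so it amounts to a bilinear form on the span of the \<open>e\<close> and \<open>f\<close>. With \<open>N\<close> the nilpotent shift
  (\<open>N\<close> has ones just below the diagonal), its \<open>e\<close>-\<open>f\<close> block is the identity for the antisymmetric part
  and \<open>S = a I + N\<close> for the symmetric part; the other blocks of both parts come from these by
  (anti)symmetry. As \<open>d z = \<gamma> z\<close>, \<open>d\<close> is a derivation iff both parts are infinitesimally
  scaled by \<open>\<gamma>\<close>, and the \<open>z\<close>-components of \<open>d (e j)\<close> and \<open>d (f j)\<close> are free.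

  Write \<open>A, C\<close> for the \<open>e\<close>- and \<open>f\<close>-coordinates of the \<open>d (e j)\<close>, and \<open>B, D\<close> for those of the
  \<open>d (f j)\<close>. The mixed brackets give \<open>D = \<gamma> I - A\<^sup>T\<close> from the antisymmetric part and
  \<open>A\<^sup>T S + S D = \<gamma> S\<close> from the symmetric part, so \<open>A\<^sup>T\<close> commutes with \<open>N\<close>: this is the Toeplitz
  shape (\<open>toeplitz_of_shift\<close>). The brackets of two \<open>e\<close> make \<open>C\<close> symmetric with
  \<open>2 a C + N C + C N\<^sup>T = 0\<close>; since \<open>C \<mapsto> N C + C N\<^sup>T\<close> is nilpotent and \<open>a \<noteq> 0\<close>, \<open>C = 0\<close>
  (\<open>skew_recurrence_zero\<close>), and likewise \<open>B = 0\<close>. The elementary form of this computation is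
  \<open>coordinate_equations_iff\<close>; \<open>derivation_iff_coordinates\<close> and \<open>matrix_of_eq_iff\<close> translate the
  derivation property and the matrix identity into coordinates.
\<close>

section \<open>The equations on coordinates\<close>

lemma pred_in_range: "k - 1 = 0 \<or> k - 1 \<in> {1..n}" if "k \<in> {1..n}" for k n :: nat
  using that by auto

text \<open>Subtracting the equation for \<open>(k, j)\<close> from that for \<open>(j, k)\<close> shows that \<open>C\<close> is symmetric;
  then \<open>2 a C k j\<close> is determined by entries with a smaller index sum, so everything vanishes
  by induction from the boundary.\<close>

lemma skew_recurrence_zero:
  fixes C :: "nat \<Rightarrow> nat \<Rightarrow> complex"
  assumes "a \<noteq> 0"
    and bdry: "\<And>j. C 0 j = 0"
    and eq: "\<And>j k. j \<in> {1..n} \<Longrightarrow> k \<in> {1..n} \<Longrightarrow>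
       (a - 1) * C k j + C (k - 1) j + ((a + 1) * C j k + C (j - 1) k) = 0"
    and "k \<in> {1..n}" "j \<in> {1..n}"
  shows "C k j = 0"
proof -
  have sym: "C k j = C j k" if "k \<in> {1..n}" "j \<in> {1..n}" for k j
  proof -
    have "2 * (C k j - C j k) =
        ((a - 1) * C j k + C (j - 1) k + ((a + 1) * C k j + C (k - 1) j))
        - ((a - 1) * C k j + C (k - 1) j + ((a + 1) * C j k + C (j - 1) k))"
      by (simp add: algebra_simps)
    also have "\<dots> = 0"
      using eq[OF that] eq[OF that(2,1)] by simp
    finally show ?thesis by simp
  qed
  have "C k j = 0" if "k + j = m" "k \<in> {1..n}" "j \<in> {1..n}" for m
    using that
  proof (induction m arbitrary: k j rule: less_induct)
    case (less m)
    have "C (k - 1) j = 0"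
      using pred_in_range[OF less.prems(2)] less.IH[of "k - 1 + j" "k - 1" j] less.prems bdry
      by auto
    moreover have "C (j - 1) k = 0"
      using pred_in_range[OF less.prems(3)] less.IH[of "j - 1 + k" "j - 1" k] less.prems bdry
      by auto
    ultimately have "2 * a * C k j = 0"
      using eq[OF less.prems(3) less.prems(2)] sym[OF less.prems(2,3)]
      by (simp add: algebra_simps)
    then show ?case using \<open>a \<noteq> 0\<close> by simp
  qed
  then show ?thesis using assms(4,5) by blast
qed

text \<open>For the brackets of two \<open>f\<close> the shift goes upwards; reversing the order of the indices
  reduces this to the previous lemma.\<close>

lemma skew_recurrence_zero_rev:
  fixes B :: "nat \<Rightarrow> nat \<Rightarrow> complex"
  assumes "a \<noteq> 0"
    and bdry: "\<And>j. B (n + 1) j = 0"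
    and eq: "\<And>j k. j \<in> {1..n} \<Longrightarrow> k \<in> {1..n} \<Longrightarrow>
       (a + 1) * B k j + B (k + 1) j + ((a - 1) * B j k + B (j + 1) k) = 0"
    and kj: "k \<in> {1..n}" "j \<in> {1..n}"
  shows "B k j = 0"
proof -
  define C where "C = (\<lambda>i j. B (n + 1 - i) (n + 1 - j))"
  have "(a - 1) * C k j + C (k - 1) j + ((a + 1) * C j k + C (j - 1) k) = 0"
    if "j \<in> {1..n}" "k \<in> {1..n}" for j k
  proof -
    have *: "n + 1 - (k - 1) = n + 1 - k + 1" "n + 1 - (j - 1) = n + 1 - j + 1"
      using that by auto
    have "n + 1 - k \<in> {1..n}" "n + 1 - j \<in> {1..n}" using that by auto
    from eq[OF this] show ?thesis unfolding C_def * by (simp add: algebra_simps)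
  qed
  moreover have "C 0 j = 0" for j by (simp add: C_def bdry[simplified])
  ultimately have "C (n + 1 - k) (n + 1 - j) = 0"
    using skew_recurrence_zero[of a C n "n + 1 - k" "n + 1 - j"] \<open>a \<noteq> 0\<close> kj by force
  then show ?thesis using kj by (simp add: C_def)
qed

text \<open>The entrywise form of commuting with the nilpotent shift: moving down a diagonal preserves the
  entry, and the diagonals that start in the first column below the corner are zero.\<close>

lemma toeplitz_of_shift:
  fixes A :: "nat \<Rightarrow> nat \<Rightarrow> 'b::zero"
  assumes first: "\<And>k. k \<in> {1..n} \<Longrightarrow> A (k + 1) 1 = 0"
    and shift: "\<And>k j. k \<in> {1..n} \<Longrightarrow> j \<in> {2..n} \<Longrightarrow> A (k + 1) j = A k (j - 1)"
    and "i \<in> {1..n}" "j \<in> {1..n}"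
  shows "A i j = (if i \<le> j then A 1 (j - i + 1) else 0)"
  using assms(3,4)
proof (induction i arbitrary: j)
  case (Suc i)
  show ?case
  proof (cases "i = 0")
    case False
    then have i: "i \<in> {1..n}" using Suc.prems by auto
    show ?thesis
    proof (cases "j = 1")
      case True
      then show ?thesis using first[OF i] False by simp
    next
      case False
      then have j: "j \<in> {2..n}" "j - 1 \<in> {1..n}" using Suc.prems by auto
      show ?thesis using shift[OF i j(1)] Suc.IH[OF i j(2)] j by auto
    qed
  qed (use Suc.prems in auto)
qed simp

text \<open>The second index numbers the basis vector to which the derivation \<open>d\<close> is applied. The four families of equations
  are the derivation property on the pairs \<open>(e j, e k)\<close>, \<open>(f j, f k)\<close>, \<open>(e j, f k)\<close> and
  \<open>(f k, e j)\<close>. Zero entries just outside the range \<open>1, \<dots>, n\<close> absorb the boundary cases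
  of the structure constants.\<close>

lemma coordinate_equations_iff:
  fixes A B C D :: "nat \<Rightarrow> nat \<Rightarrow> complex"
  assumes "a \<noteq> 0" "n \<ge> 1"
    and A0: "\<And>j. A (n + 1) j = 0" and B0: "\<And>j. B (n + 1) j = 0"
    and C0: "\<And>j. C 0 j = 0" and D0: "\<And>j. D 0 j = 0"
  shows "(\<forall>j\<in>{1..n}. \<forall>k\<in>{1..n}.
       (a - 1) * C k j + C (k - 1) j + ((a + 1) * C j k + C (j - 1) k) = 0 \<and>
       (a + 1) * B k j + B (k + 1) j + ((a - 1) * B j k + B (j + 1) k) = 0 \<and>
       (a + 1) * A k j + A (k + 1) j + ((a + 1) * D j k + D (j - 1) k)
         = \<gamma> * (if k = j then 1 + a else if j = k + 1 then 1 else 0) \<and>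
       (a - 1) * D j k + D (j - 1) k + ((a - 1) * A k j + A (k + 1) j)
         = \<gamma> * (if k = j then - 1 + a else if j = k + 1 then 1 else 0)) \<longleftrightarrow>
     (\<exists>\<alpha> \<beta>. \<gamma> = \<alpha> 1 + \<beta> \<and> (\<forall>i\<in>{1..n}. \<forall>j\<in>{1..n}.
        A i j = (if i \<le> j then \<alpha> (j - i + 1) else 0) \<and> B i j = 0 \<and> C i j = 0 \<and>
        D i j = (if i = j then \<beta> else if i > j then - \<alpha> (i - j + 1) else 0)))"
    (is "?eqs \<longleftrightarrow> ?form")
proof
  assume eqs: ?eqs
  \<comment> \<open>The difference of the two mixed equations is the antisymmetric part of the bracket; once
    it is known, either of them yields the contribution of the shift.\<close>
  have sums: "A k j + D j k = (if k = j then \<gamma> else 0) \<and>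
      A (k + 1) j + D (j - 1) k = (if j = k + 1 then \<gamma> else 0)"
    if jk: "j \<in> {1..n}" "k \<in> {1..n}" for j k
  proof -
    define p q r :: complex where "p = (if k = j then 1 + a else if j = k + 1 then 1 else 0)"
      and "q = (if k = j then - 1 + a else if j = k + 1 then 1 else 0)"
      and "r = (if k = j then 1 else 0)"
    define s :: complex where "s = (if j = k + 1 then 1 else 0)"
    have pq: "p = (1 + a) * r + s" "q = (a - 1) * r + s"
      by (auto simp: p_def q_def r_def s_def)
    have ef: "(a + 1) * A k j + A (k + 1) j + ((a + 1) * D j k + D (j - 1) k) = \<gamma> * p"
      and fe: "(a - 1) * D j k + D (j - 1) k + ((a - 1) * A k j + A (k + 1) j) = \<gamma> * q"
      using eqs[rule_format, OF jk] unfolding p_def q_def by blast+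
    have "2 * (A k j + D j k) = \<gamma> * p - \<gamma> * q"
      unfolding ef[symmetric] fe[symmetric] by (simp add: algebra_simps)
    also have "\<dots> = 2 * (\<gamma> * r)"
      unfolding pq by (simp add: algebra_simps)
    finally have "2 * (A k j + D j k) = 2 * (\<gamma> * r)" .
    then have 1: "A k j + D j k = \<gamma> * r"
      by (subst (asm) mult_cancel_left) simp
    have "A (k + 1) j + D (j - 1) k = \<gamma> * p - (a + 1) * (A k j + D j k)"
      unfolding ef[symmetric] by (simp add: algebra_simps)
    also have "\<dots> = \<gamma> * s"
      unfolding 1 pq by (simp add: algebra_simps)
    finally have 2: "A (k + 1) j + D (j - 1) k = \<gamma> * s" .
    from 1 2 show ?thesis by (auto simp: r_def s_def)
  qed
  have D: "D j k = (if k = j then \<gamma> else 0) - A k j" if "j \<in> {1..n}" "k \<in> {1..n}" for j k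
    using sums[OF that] by (simp add: algebra_simps)
  have rest: "A (k + 1) j + D (j - 1) k = (if j = k + 1 then \<gamma> else 0)"
    if "j \<in> {1..n}" "k \<in> {1..n}" for j k
    using sums[OF that] by blast
  have first: "A (k + 1) 1 = 0" if "k \<in> {1..n}" for k
    using rest[of 1 k] that \<open>n \<ge> 1\<close> D0 by auto
  have shift: "A (k + 1) j = A k (j - 1)" if "k \<in> {1..n}" "j \<in> {2..n}" for k j
  proof -
    have "j \<in> {1..n}" "j - 1 \<in> {1..n}" "j = k + 1 \<longleftrightarrow> k = j - 1" using that by auto
    with rest[of j k] D[of "j - 1" k] that(1) show ?thesis by (auto split: if_splits)
  qed
  have A: "A i j = (if i \<le> j then A 1 (j - i + 1) else 0)"
    if "i \<in> {1..n}" "j \<in> {1..n}" for i j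
    using toeplitz_of_shift[of n A i j] first shift that by blast
  have "C i j = 0" if "i \<in> {1..n}" "j \<in> {1..n}" for i j
    using skew_recurrence_zero[of a C n i j] eqs \<open>a \<noteq> 0\<close> C0 that by blast
  moreover have "B i j = 0" if "i \<in> {1..n}" "j \<in> {1..n}" for i j
    using skew_recurrence_zero_rev[of a B n i j] eqs \<open>a \<noteq> 0\<close> B0 that by blast
  moreover have "D i j = (if i = j then \<gamma> - A 1 1 else if i > j then - A 1 (i - j + 1) else 0)"
    if "i \<in> {1..n}" "j \<in> {1..n}" for i j
    using D[OF that] A[OF that(2,1)] by auto
  ultimately show ?form
    using A by (intro exI[of _ "A 1"] exI[of _ "\<gamma> - A 1 1"]) auto
next
  assume ?form
  then obtain \<alpha> \<beta> where \<gamma>: "\<gamma> = \<alpha> 1 + \<beta>"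
    and f: "\<And>i j. i\<in>{1..n} \<Longrightarrow> j\<in>{1..n} \<Longrightarrow>
        A i j = (if i \<le> j then \<alpha> (j - i + 1) else 0) \<and> B i j = 0 \<and> C i j = 0 \<and>
        D i j = (if i = j then \<beta> else if i > j then - \<alpha> (i - j + 1) else 0)"
    by blast
  have C: "C (k - 1) j = 0" if "k\<in>{1..n}" "j\<in>{1..n}" for k j
    using pred_in_range[OF that(1)] f[of "k - 1" j] C0 that(2) by auto
  have B: "B (k + 1) j = 0" if "k\<in>{1..n}" "j\<in>{1..n}" for k j
    using f[of "k + 1" j] B0 that by (cases "k = n") auto
  have A: "A (k + 1) j = (if k < j then \<alpha> (j - k) else 0)" if "k\<in>{1..n}" "j\<in>{1..n}" for k j
    using f[of "k + 1" j] A0[of j] that by (cases "k = n") (auto simp: Suc_diff_Suc)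
  have D: "D (j - 1) k = (if j = k + 1 then \<beta> else if j > k then - \<alpha> (j - k) else 0)"
    if "k\<in>{1..n}" "j\<in>{1..n}" for k j
    using f[of "j - 1" k] D0[of k] that by (cases j; cases "j - 1") (auto simp: Suc_diff_le)
  show ?eqs
  proof (intro ballI)
    fix j k assume jk: "j \<in> {1..n}" "k \<in> {1..n}"
    show "(a - 1) * C k j + C (k - 1) j + ((a + 1) * C j k + C (j - 1) k) = 0 \<and>
       (a + 1) * B k j + B (k + 1) j + ((a - 1) * B j k + B (j + 1) k) = 0 \<and>
       (a + 1) * A k j + A (k + 1) j + ((a + 1) * D j k + D (j - 1) k)
         = \<gamma> * (if k = j then 1 + a else if j = k + 1 then 1 else 0) \<and>
       (a - 1) * D j k + D (j - 1) k + ((a - 1) * A k j + A (k + 1) j)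
         = \<gamma> * (if k = j then - 1 + a else if j = k + 1 then 1 else 0)"
      unfolding A[OF jk(2,1)] B[OF jk(2,1)] B[OF jk(1,2)] C[OF jk(2,1)] C[OF jk(1,2)] D[OF jk(2,1)]
      using f[OF jk] f[OF jk(2,1)] by (auto simp: \<gamma> algebra_simps)
  qed
qed

section \<open>Coordinates in the Heisenberg Leibniz algebra\<close>

context heisenberg_leibniz
begin

text \<open>Coordinates vanish outside \<open>1, \<dots>, n\<close>, so that the bracket formulas below need no case
  distinction at the ends of the shift.\<close>

definition e_coord :: "'v \<Rightarrow> nat \<Rightarrow> complex" where
  "e_coord v i =
     (if i \<in> {1..n} then representation (set (heis_basis n e f z)) v (e i) else 0)"

definition f_coord :: "'v \<Rightarrow> nat \<Rightarrow> complex" where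
  "f_coord v i =
     (if i \<in> {1..n} then representation (set (heis_basis n e f z)) v (f i) else 0)"

lemma set_heis_basis: "set (heis_basis n e f z) = e ` {1..n} \<union> f ` {1..n} \<union> {z}"
  by (auto simp: heis_basis_def)

lemma in_heis_basis:
  "i \<in> {1..n} \<Longrightarrow> e i \<in> set (heis_basis n e f z)"
  "i \<in> {1..n} \<Longrightarrow> f i \<in> set (heis_basis n e f z)"
  "z \<in> set (heis_basis n e f z)"
  unfolding set_heis_basis by auto

lemma e_eq_iff: "i \<in> {1..n} \<Longrightarrow> j \<in> {1..n} \<Longrightarrow> e i = e j \<longleftrightarrow> i = j"
  and f_eq_iff: "i \<in> {1..n} \<Longrightarrow> j \<in> {1..n} \<Longrightarrow> f i = f j \<longleftrightarrow> i = j"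
  and e_neq_f: "i \<in> {1..n} \<Longrightarrow> j \<in> {1..n} \<Longrightarrow> e i \<noteq> f j"
  and e_neq_z: "i \<in> {1..n} \<Longrightarrow> e i \<noteq> z"
  and f_neq_z: "i \<in> {1..n} \<Longrightarrow> f i \<noteq> z"
proof -
  have upt: "set [1..<n + 1] = {1..n}" by auto
  have "inj_on e {1..n}" "inj_on f {1..n}" "e ` {1..n} \<inter> f ` {1..n} = {}"
    "z \<notin> e ` {1..n}" "z \<notin> f ` {1..n}"
    using basis_distinct
    unfolding heis_basis_def distinct_append distinct_map set_append set_map upt by auto
  then show "i \<in> {1..n} \<Longrightarrow> j \<in> {1..n} \<Longrightarrow> e i = e j \<longleftrightarrow> i = j"
    "i \<in> {1..n} \<Longrightarrow> j \<in> {1..n} \<Longrightarrow> f i = f j \<longleftrightarrow> i = j"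
    "i \<in> {1..n} \<Longrightarrow> j \<in> {1..n} \<Longrightarrow> e i \<noteq> f j"
    "i \<in> {1..n} \<Longrightarrow> e i \<noteq> z" "i \<in> {1..n} \<Longrightarrow> f i \<noteq> z"
    by (auto simp only: inj_on_eq_iff)
qed

lemma representation_basis_vector:
  "b \<in> set (heis_basis n e f z) \<Longrightarrow>
   representation (set (heis_basis n e f z)) b c = (if c = b then 1 else 0)"
  using representation_basis[OF basis_independent] by simp

lemma e_coord_basis [simp]:
  "j \<in> {1..n} \<Longrightarrow> e_coord (e j) i = (if i = j then 1 else 0)"
  "j \<in> {1..n} \<Longrightarrow> e_coord (f j) i = 0"
  "e_coord z i = 0"
  by (simp_all add: e_coord_def representation_basis_vector in_heis_basis e_eq_iff e_neq_f e_neq_z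
      del: atLeastAtMost_iff)

lemma f_coord_basis [simp]:
  "j \<in> {1..n} \<Longrightarrow> f_coord (f j) i = (if i = j then 1 else 0)"
  "j \<in> {1..n} \<Longrightarrow> f_coord (e j) i = 0"
  "f_coord z i = 0"
  by (simp_all add: f_coord_def representation_basis_vector in_heis_basis f_eq_iff
      e_neq_f[symmetric] f_neq_z del: atLeastAtMost_iff)

lemma coord_linear [simp]:
  "e_coord (u + v) i = e_coord u i + e_coord v i"
  "f_coord (u + v) i = f_coord u i + f_coord v i"
  "e_coord (scale c v) i = c * e_coord v i"
  "f_coord (scale c v) i = c * f_coord v i"
  by (auto simp: e_coord_def f_coord_def representation_add[OF basis_independent]
      representation_scale[OF basis_independent] basis_span)

lemma linearI:
  assumes "\<And>u v. g (u + v) = g u + g v" "\<And>c v. g (scale c v) = scale c (g v)"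
  shows "Vector_Spaces.linear scale scale g"
  using assms vector_space_axioms by (simp add: Vector_Spaces.linear_iff)

lemma linear_eq_on_basis:
  assumes g: "Vector_Spaces.linear scale scale g" and h: "Vector_Spaces.linear scale scale h"
    and "\<And>i. i \<in> {1..n} \<Longrightarrow> g (e i) = h (e i)" "\<And>i. i \<in> {1..n} \<Longrightarrow> g (f i) = h (f i)" "g z = h z"
  shows "g v = h v"
proof (rule vector_space_pair.linear_eq_on_span[OF _ g h,
      where B = "set (heis_basis n e f z)"])
  show "vector_space_pair scale scale"
    by (intro vector_space_pair.intro vector_space_axioms)
qed (use assms basis_span in \<open>auto simp: set_heis_basis\<close>)

lemma br_linear [simp]:
  "br (u + v) w = br u w + br v w" "br w (u + v) = br w u + br w v"
  "br (scale c u) w = scale c (br u w)" "br w (scale c u) = scale c (br w u)"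
  using bilinear by (simp_all add: bilinear_bracket_def Vector_Spaces.linear_iff)

lemma br_coord:
  assumes k: "k \<in> {1..n}"
  shows "br v (f k) = scale ((a + 1) * e_coord v k + e_coord v (k + 1)) z"
    and "br v (e k) = scale ((a - 1) * f_coord v k + f_coord v (k - 1)) z"
    and "br (f k) v = scale ((a - 1) * e_coord v k + e_coord v (k + 1)) z"
    and "br (e k) v = scale ((a + 1) * f_coord v k + f_coord v (k - 1)) z"
proof -
  show "br v (f k) = scale ((a + 1) * e_coord v k + e_coord v (k + 1)) z"
  proof (rule linear_eq_on_basis[where g = "\<lambda>x. br x (f k)"
        and h = "\<lambda>x. scale ((a + 1) * e_coord x k + e_coord x (k + 1)) z"])
    show "Vector_Spaces.linear scale scale (\<lambda>x. br x (f k))"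
      "Vector_Spaces.linear scale scale (\<lambda>x. scale ((a + 1) * e_coord x k + e_coord x (k + 1)) z)"
      by (rule linearI; simp add: scale_left_distrib scale_right_distrib distrib_left ac_simps)+
  qed (use k in \<open>auto simp: br_e_f br_f_f br_z_left in_heis_basis\<close>)
  show "br v (e k) = scale ((a - 1) * f_coord v k + f_coord v (k - 1)) z"
  proof (rule linear_eq_on_basis[where g = "\<lambda>x. br x (e k)"
        and h = "\<lambda>x. scale ((a - 1) * f_coord x k + f_coord x (k - 1)) z"])
    show "Vector_Spaces.linear scale scale (\<lambda>x. br x (e k))"
      "Vector_Spaces.linear scale scale (\<lambda>x. scale ((a - 1) * f_coord x k + f_coord x (k - 1)) z)"
      by (rule linearI; simp add: scale_left_distrib scale_right_distrib distrib_left ac_simps)+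
  qed (use k in \<open>auto simp: br_f_e br_e_e br_z_left in_heis_basis\<close>)
  show "br (f k) v = scale ((a - 1) * e_coord v k + e_coord v (k + 1)) z"
  proof (rule linear_eq_on_basis[where g = "\<lambda>x. br (f k) x"
        and h = "\<lambda>x. scale ((a - 1) * e_coord x k + e_coord x (k + 1)) z"])
    show "Vector_Spaces.linear scale scale (\<lambda>x. br (f k) x)"
      "Vector_Spaces.linear scale scale (\<lambda>x. scale ((a - 1) * e_coord x k + e_coord x (k + 1)) z)"
      by (rule linearI; simp add: scale_left_distrib scale_right_distrib distrib_left ac_simps)+
  qed (use k in \<open>auto simp: br_f_e br_f_f br_z_right in_heis_basis\<close>)
  show "br (e k) v = scale ((a + 1) * f_coord v k + f_coord v (k - 1)) z"
  proof (rule linear_eq_on_basis[where g = "\<lambda>x. br (e k) x"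
        and h = "\<lambda>x. scale ((a + 1) * f_coord x k + f_coord x (k - 1)) z"])
    show "Vector_Spaces.linear scale scale (\<lambda>x. br (e k) x)"
      "Vector_Spaces.linear scale scale (\<lambda>x. scale ((a + 1) * f_coord x k + f_coord x (k - 1)) z)"
      by (rule linearI; simp add: scale_left_distrib scale_right_distrib distrib_left ac_simps)+
  qed (use k in \<open>auto simp: br_e_f br_e_e br_z_right in_heis_basis\<close>)
qed

lemma scale_z_eq_iff [simp]: "scale c z = scale c' z \<longleftrightarrow> c = c'"
  using basis_independent dependent_zero[of "set (heis_basis n e f z)"]
  by (auto simp: set_heis_basis)

lemma br_z [simp]: "br z v = 0" "br v z = 0"
  by (rule linear_eq_on_basis[of "\<lambda>v. br z v" "\<lambda>v. 0"] linear_eq_on_basis[of "\<lambda>v. br v z" "\<lambda>v. 0"];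
      (intro linearI)?; simp add: br_z_left br_z_right set_heis_basis)+

lemma derivation_iff_coordinates:
  assumes d: "Vector_Spaces.linear scale scale d" and dz: "d z = scale \<gamma> z"
  shows "derivation scale br d \<longleftrightarrow> (\<forall>j\<in>{1..n}. \<forall>k\<in>{1..n}.
       (a - 1) * f_coord (d (e j)) k + f_coord (d (e j)) (k - 1)
         + ((a + 1) * f_coord (d (e k)) j + f_coord (d (e k)) (j - 1)) = 0 \<and>
       (a + 1) * e_coord (d (f j)) k + e_coord (d (f j)) (k + 1)
         + ((a - 1) * e_coord (d (f k)) j + e_coord (d (f k)) (j + 1)) = 0 \<and>
       (a + 1) * e_coord (d (e j)) k + e_coord (d (e j)) (k + 1)
         + ((a + 1) * f_coord (d (f k)) j + f_coord (d (f k)) (j - 1))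
         = \<gamma> * (if k = j then 1 + a else if j = k + 1 then 1 else 0) \<and>
       (a - 1) * f_coord (d (f k)) j + f_coord (d (f k)) (j - 1)
         + ((a - 1) * e_coord (d (e j)) k + e_coord (d (e j)) (k + 1))
         = \<gamma> * (if k = j then - 1 + a else if j = k + 1 then 1 else 0))"
    (is "_ \<longleftrightarrow> ?eqs")
proof -
  have d_lin [simp]: "d (u + v) = d u + d v" "d (scale c v) = scale c (d v)" for u v c
    using d by (simp_all add: Vector_Spaces.linear_iff)
  have d0 [simp]: "d 0 = 0" using d_lin(2)[of 0 0] by simp
  \<comment> \<open>Both sides of the product rule are linear in each argument, and both vanish when an argument
    is \<open>z\<close>, because \<open>d z\<close> is a multiple of \<open>z\<close>.\<close>
  let ?P = "\<lambda>x y. d (br x y) = br (d x) y + br x (d y)"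
  have from_basis: "?P x y" if base: "\<And>i j. i \<in> {1..n} \<Longrightarrow> j \<in> {1..n} \<Longrightarrow>
      ?P (e i) (e j) \<and> ?P (e i) (f j) \<and> ?P (f i) (e j) \<and> ?P (f i) (f j)" for x y
  proof -
    have e: "?P (e i) y" if i: "i \<in> {1..n}" for i y
      by (rule linear_eq_on_basis[of "\<lambda>y. d (br (e i) y)"]; (intro linearI)?)
        (use base i in \<open>auto simp: algebra_simps dz\<close>)
    have f: "?P (f i) y" if i: "i \<in> {1..n}" for i y
      by (rule linear_eq_on_basis[of "\<lambda>y. d (br (f i) y)"]; (intro linearI)?)
        (use base i in \<open>auto simp: algebra_simps dz\<close>)
    show ?thesis
      by (rule linear_eq_on_basis[of "\<lambda>x. d (br x y)"]; (intro linearI)?)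
        (use e f in \<open>auto simp: algebra_simps dz\<close>)
  qed
  have "derivation scale br d \<longleftrightarrow> (\<forall>j\<in>{1..n}. \<forall>k\<in>{1..n}.
      ?P (e j) (e k) \<and> ?P (f j) (f k) \<and> ?P (e j) (f k) \<and> ?P (f k) (e j))"
    unfolding derivation_def using d from_basis by blast
  also have "\<dots> \<longleftrightarrow> ?eqs"
  proof (intro ball_cong refl)
    fix j k assume jk: "j \<in> {1..n}" "k \<in> {1..n}"
    have dee: "d (br (e j) (e k)) = scale 0 z" and dff: "d (br (f j) (f k)) = scale 0 z"
      by (simp_all only: br_e_e[OF jk] br_f_f[OF jk] d0 scale_zero_left)
    have ee: "?P (e j) (e k) \<longleftrightarrow> scale 0 z = scale (
        (a - 1) * f_coord (d (e j)) k + f_coord (d (e j)) (k - 1)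
         + ((a + 1) * f_coord (d (e k)) j + f_coord (d (e k)) (j - 1))) z"
      unfolding dee by (simp only: br_coord[OF jk(1)] br_coord[OF jk(2)] scale_left_distrib)
    have ff: "?P (f j) (f k) \<longleftrightarrow> scale 0 z = scale (
        (a + 1) * e_coord (d (f j)) k + e_coord (d (f j)) (k + 1)
         + ((a - 1) * e_coord (d (f k)) j + e_coord (d (f k)) (j + 1))) z"
      unfolding dff by (simp only: br_coord[OF jk(1)] br_coord[OF jk(2)] scale_left_distrib)
    have def: "d (br (e j) (f k)) =
        scale (\<gamma> * (if k = j then 1 + a else if j = k + 1 then 1 else 0)) z"
      and dfe: "d (br (f k) (e j)) =
        scale (\<gamma> * (if k = j then - 1 + a else if j = k + 1 then 1 else 0)) z"
      by (simp_all add: br_e_f[OF jk] br_f_e[OF jk] dz mult.commute)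
    have ef: "?P (e j) (f k) \<longleftrightarrow>
        scale (\<gamma> * (if k = j then 1 + a else if j = k + 1 then 1 else 0)) z = scale (
        (a + 1) * e_coord (d (e j)) k + e_coord (d (e j)) (k + 1)
         + ((a + 1) * f_coord (d (f k)) j + f_coord (d (f k)) (j - 1))) z"
      unfolding def by (simp only: br_coord[OF jk(1)] br_coord[OF jk(2)] scale_left_distrib)
    have fe: "?P (f k) (e j) \<longleftrightarrow>
        scale (\<gamma> * (if k = j then - 1 + a else if j = k + 1 then 1 else 0)) z = scale (
        (a - 1) * f_coord (d (f k)) j + f_coord (d (f k)) (j - 1)
         + ((a - 1) * e_coord (d (e j)) k + e_coord (d (e j)) (k + 1))) z"
      unfolding dfe by (simp only: br_coord[OF jk(1)] br_coord[OF jk(2)] scale_left_distrib)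
    show "(?P (e j) (e k) \<and> ?P (f j) (f k) \<and> ?P (e j) (f k) \<and> ?P (f k) (e j)) \<longleftrightarrow>
       (a - 1) * f_coord (d (e j)) k + f_coord (d (e j)) (k - 1)
         + ((a + 1) * f_coord (d (e k)) j + f_coord (d (e k)) (j - 1)) = 0 \<and>
       (a + 1) * e_coord (d (f j)) k + e_coord (d (f j)) (k + 1)
         + ((a - 1) * e_coord (d (f k)) j + e_coord (d (f k)) (j + 1)) = 0 \<and>
       (a + 1) * e_coord (d (e j)) k + e_coord (d (e j)) (k + 1)
         + ((a + 1) * f_coord (d (f k)) j + f_coord (d (f k)) (j - 1))
         = \<gamma> * (if k = j then 1 + a else if j = k + 1 then 1 else 0) \<and>
       (a - 1) * f_coord (d (f k)) j + f_coord (d (f k)) (j - 1)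
         + ((a - 1) * e_coord (d (e j)) k + e_coord (d (e j)) (k + 1))
         = \<gamma> * (if k = j then - 1 + a else if j = k + 1 then 1 else 0)"
      unfolding ee ff ef fe scale_z_eq_iff
      by (metis (no_types, lifting))
  qed
  finally show ?thesis .
qed

section \<open>Comparison with the block matrix\<close>

text \<open>The last row imposes nothing since \<open>\<mu>\<close> and \<open>\<nu>\<close> can be read off from it, and the last column
  is \<open>d z = \<gamma> z\<close>. Matrix indices start at 0, indices of basis vectors at 1.\<close>

lemma matrix_of_eq_iff:
  assumes dz: "d z = scale \<gamma> z"
    and A: "A \<in> carrier_mat n n" and D: "D \<in> carrier_mat n n"
  shows "(\<exists>\<mu>\<in>carrier_vec n. \<exists>\<nu>\<in>carrier_vec n.
      matrix_of scale (heis_basis n e f z) d = derivation_matrix n A D \<mu> \<nu> \<gamma>) \<longleftrightarrow>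
    (\<forall>i\<in>{1..n}. \<forall>j\<in>{1..n}.
       e_coord (d (e j)) i = A $$ (i - 1, j - 1) \<and> e_coord (d (f j)) i = 0 \<and>
       f_coord (d (e j)) i = 0 \<and> f_coord (d (f j)) i = D $$ (i - 1, j - 1))"
    (is "?mat \<longleftrightarrow> ?coords")
proof -
  let ?bs = "heis_basis n e f z"
  let ?M = "matrix_of scale ?bs d"
  let ?r = "representation (set ?bs)"
  have len: "length ?bs = 2 * n + 1" by (simp add: heis_basis_def)
  have nth: "?bs ! i = e (i + 1)" "?bs ! (n + i) = f (i + 1)" if "i < n" for i
    using that by (auto simp: heis_basis_def nth_append simp del: upt_Suc)
  have z_nth: "?bs ! (2 * n) = z" by (auto simp: heis_basis_def nth_append)
  have M: "?M $$ (i, j) = ?r (d (?bs ! j)) (?bs ! i)" if "i < 2 * n + 1" "j < 2 * n + 1" for i j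
    using that len by (simp add: matrix_of_def)
  have entries: "derivation_matrix n A D \<mu> \<nu> \<gamma> $$ (i, j) =
     (if i < n then if j < n then A $$ (i, j) else 0
      else if i < 2 * n then if n \<le> j \<and> j < 2 * n then D $$ (i - n, j - n) else 0
      else if j < n then \<mu> $ j else if j < 2 * n then \<nu> $ (j - n) else \<gamma>)"
    if "\<mu> \<in> carrier_vec n" "\<nu> \<in> carrier_vec n" "i < 2 * n + 1" "j < 2 * n + 1" for \<mu> \<nu> i j
    using that A D by (auto simp: derivation_matrix_def)
  show ?thesis
  proof
    assume ?mat
    then obtain \<mu> \<nu> where \<mu>: "\<mu> \<in> carrier_vec n" and \<nu>: "\<nu> \<in> carrier_vec n"
      and eq: "?M = derivation_matrix n A D \<mu> \<nu> \<gamma>" by blast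
    have rep: "?r (d (?bs ! j)) (?bs ! i) = derivation_matrix n A D \<mu> \<nu> \<gamma> $$ (i, j)"
      if "i < 2 * n + 1" "j < 2 * n + 1" for i j
      using M[OF that] eq by simp
    show ?coords
    proof (intro ballI)
      fix i j assume ij: "i \<in> {1..n}" "j \<in> {1..n}"
      then have *: "i - 1 < n" "j - 1 < n" "i - 1 + 1 = i" "j - 1 + 1 = j" by auto
      show "e_coord (d (e j)) i = A $$ (i - 1, j - 1) \<and> e_coord (d (f j)) i = 0 \<and>
       f_coord (d (e j)) i = 0 \<and> f_coord (d (f j)) i = D $$ (i - 1, j - 1)"
        using rep[of "i - 1" "j - 1"] rep[of "i - 1" "n + (j - 1)"]
          rep[of "n + (i - 1)" "j - 1"] rep[of "n + (i - 1)" "n + (j - 1)"]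
          nth[OF *(1)] nth[OF *(2)] * ij
        by (auto simp: entries[OF \<mu> \<nu>] e_coord_def f_coord_def)
    qed
  next
    assume c: ?coords
    define \<mu> where "\<mu> = vec n (\<lambda>j. ?r (d (e (j + 1))) z)"
    define \<nu> where "\<nu> = vec n (\<lambda>j. ?r (d (f (j + 1))) z)"
    have mn: "\<mu> \<in> carrier_vec n" "\<nu> \<in> carrier_vec n" by (auto simp: \<mu>_def \<nu>_def)
    have mn_nth: "\<mu> $ j = ?r (d (e (j + 1))) z" "\<nu> $ j = ?r (d (f (j + 1))) z" if "j < n" for j
      using that by (simp_all add: \<mu>_def \<nu>_def)
    have c': "?r (d (e (j + 1))) (e (i + 1)) = A $$ (i, j)" "?r (d (f (j + 1))) (e (i + 1)) = 0"
       "?r (d (e (j + 1))) (f (i + 1)) = 0" "?r (d (f (j + 1))) (f (i + 1)) = D $$ (i, j)"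
      if "i < n" "j < n" for i j
      using c[rule_format, of "i + 1" "j + 1"] that by (auto simp: e_coord_def f_coord_def)
    have rz: "?r (d z) b = (if b = z then \<gamma> else 0)" for b
      using basis_span by (simp add: dz representation_scale[OF basis_independent]
          representation_basis_vector in_heis_basis(3))
    have index_cases: "P i"
      if bound: "i < 2 * n + 1" and blocks: "\<And>k. k < n \<Longrightarrow> P k" "\<And>k. k < n \<Longrightarrow> P (n + k)"
      "P (2 * n)" for P and i :: nat
    proof -
      consider "i < n" | "i = n + (i - n)" "i - n < n" | "i = 2 * n" using bound by linarith
      then show ?thesis using blocks by cases metis+
    qed
    have "?r (d (?bs ! j)) (?bs ! i) = derivation_matrix n A D \<mu> \<nu> \<gamma> $$ (i, j)"
      if i: "i < 2 * n + 1" and j: "j < 2 * n + 1" for i j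
      using i
    proof (rule index_cases)
      show "?r (d (?bs ! j)) (?bs ! k) = derivation_matrix n A D \<mu> \<nu> \<gamma> $$ (k, j)"
        if k: "k < n" for k
        using j by (rule index_cases)
          (use k e_neq_z[of "k + 1"] c' in \<open>auto simp: entries[OF mn] nth z_nth rz\<close>)
      show "?r (d (?bs ! j)) (?bs ! (n + k)) = derivation_matrix n A D \<mu> \<nu> \<gamma> $$ (n + k, j)"
        if k: "k < n" for k
        using j by (rule index_cases)
          (use k f_neq_z[of "k + 1"] c' in \<open>auto simp: entries[OF mn] nth z_nth rz\<close>)
      show "?r (d (?bs ! j)) (?bs ! (2 * n)) = derivation_matrix n A D \<mu> \<nu> \<gamma> $$ (2 * n, j)"
        using j by (rule index_cases)
          (auto simp: entries[OF mn] nth z_nth rz mn_nth)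
    qed
    moreover have "derivation_matrix n A D \<mu> \<nu> \<gamma> \<in> carrier_mat (2 * n + 1) (2 * n + 1)"
      using A D by (auto simp: derivation_matrix_def intro!: carrier_matI)
    ultimately have "?M = derivation_matrix n A D \<mu> \<nu> \<gamma>"
      using M by (intro eq_matI) (auto simp: matrix_of_def len)
    then show ?mat using mn by blast
  qed
qed

end

theorem mainTheorem4:
  fixes scale :: "complex \<Rightarrow> 'v::ab_group_add \<Rightarrow> 'v"
    and n :: nat and a \<gamma> :: complex
    and br :: "'v \<Rightarrow> 'v \<Rightarrow> 'v"
    and e f :: "nat \<Rightarrow> 'v" and z :: 'v
    and d :: "'v \<Rightarrow> 'v"
  assumes "n \<ge> 1" and "a \<noteq> 0"
    and "heisenberg_leibniz scale n a br e f z"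
    and "Vector_Spaces.linear scale scale d"
    and "d z = scale \<gamma> z"
  shows "derivation scale br d \<longleftrightarrow>
    (\<exists>(\<alpha> :: nat \<Rightarrow> complex) (\<beta>\<^sub>1 :: complex). \<exists>\<mu> \<in> carrier_vec n. \<exists>\<nu> \<in> carrier_vec n.
       \<gamma> = \<alpha> 1 + \<beta>\<^sub>1 \<and>
       matrix_of scale (heis_basis n e f z) d =
         derivation_matrix n (toeplitz_A n \<alpha>) (toeplitz_D n \<alpha> \<beta>\<^sub>1) \<mu> \<nu> \<gamma>)"
proof -
  interpret heisenberg_leibniz scale n a br e f z by fact
  have car: "toeplitz_A n \<alpha> \<in> carrier_mat n n" "toeplitz_D n \<alpha> \<beta> \<in> carrier_mat n n" for \<alpha> \<beta>
    by (simp_all add: toeplitz_A_def toeplitz_D_def)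
  have toep: "toeplitz_A n \<alpha> $$ (i - 1, j - 1) = (if i \<le> j then \<alpha> (j - i + 1) else 0)"
    "toeplitz_D n \<alpha> \<beta> $$ (i - 1, j - 1) =
       (if i = j then \<beta> else if i > j then - \<alpha> (i - j + 1) else 0)"
    if "i \<in> {1..n}" "j \<in> {1..n}" for i j \<alpha> \<beta>
    using that by (auto simp: toeplitz_A_def toeplitz_D_def)
  have "derivation scale br d \<longleftrightarrow> (\<exists>\<alpha> \<beta>. \<gamma> = \<alpha> 1 + \<beta> \<and> (\<forall>i\<in>{1..n}. \<forall>j\<in>{1..n}.
      e_coord (d (e j)) i = (if i \<le> j then \<alpha> (j - i + 1) else 0) \<and>
      e_coord (d (f j)) i = 0 \<and> f_coord (d (e j)) i = 0 \<and>
      f_coord (d (f j)) i = (if i = j then \<beta> else if i > j then - \<alpha> (i - j + 1) else 0)))"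
    unfolding derivation_iff_coordinates[OF assms(4,5)]
    by (rule coordinate_equations_iff[where A = "\<lambda>i j. e_coord (d (e j)) i"
          and B = "\<lambda>i j. e_coord (d (f j)) i" and C = "\<lambda>i j. f_coord (d (e j)) i"
          and D = "\<lambda>i j. f_coord (d (f j)) i", OF \<open>a \<noteq> 0\<close> \<open>n \<ge> 1\<close>])
      (auto simp: e_coord_def f_coord_def)
  also have "\<dots> \<longleftrightarrow> (\<exists>\<alpha> \<beta>. \<gamma> = \<alpha> 1 + \<beta> \<and> (\<exists>\<mu>\<in>carrier_vec n. \<exists>\<nu>\<in>carrier_vec n.
      matrix_of scale (heis_basis n e f z) d =
        derivation_matrix n (toeplitz_A n \<alpha>) (toeplitz_D n \<alpha> \<beta>) \<mu> \<nu> \<gamma>))"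
    unfolding matrix_of_eq_iff[where d = d, OF assms(5) car]
    by (intro ex_cong1 conj_cong refl ball_cong) (simp_all only: toep)
  finally show ?thesis by blast
qed

end
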